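(* Let $k$ be an arbitrary field. Then any $3$-dimensional supersolvable algebra over $k$ is isomorphic to an algebra from the following list: (1) $A^0_i$ or $A^1_i$, for $i=1,\dots,5$, if $\mathrm{char}(k)\neq2$ and $k=k^2$. (2) $A^0_i$, $A^1_i$, $A^0(d)$, $B_1(d)$ or $B_2(d)$, for $i=1,\dots,5$ and $d\in S$, if $\mathrm{char}(k)\neq2$ and $k\neq k^2$. (3) $A^0_i$, $C^1_1$, $C^1_2(c)$, $C^1_3$, $C^1_4(c)$ or $C^1_5$, for $i=1,\dots,5$ and $c\in T$, if $\mathrm{char}(k)=2$ and $k=k^2$. (4) $A^0_i$, $A^0(d)$, $C^1_1$, $C^1_2(c)$, $C^1_3$, $C^1_4(c)$, $C^1_5$, $D_1(\delta)$ or $D_2(\delta)$, for $i=1,\dots,5$, $d\in S$, $c\in T$ and $\delta\in R$, if $\mathrm{char}(k)=2$ and $k\neq k^2$.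
   Context: "Algebra" means unital associative $k$-algebra. A finite-dimensional algebra $E$ is supersolvable if there is a finite chain of (unital) subalgebras $k=E_0\subset E_1\subset\cdots\subset E_m=E$ with $E_i$ of codimension $1$ in $E_{i+1}$ for all $i=0,\dots,m-1$. $k^2=\{q^2\mid q\in k\}$. If $k\neq k^2$, $S\subseteq k\setminus k^2$ is a system of representatives for the equivalence relation on $k\setminus k^2$: $d\equiv d'$ iff $d=q^2d'$ for some $q\in k^*$. If $\mathrm{char}(k)=2$ and $k\neq k^2$, $R\subseteq k\setminus k^2$ is a system of representatives for the equivalence relation on $k\setminus k^2$: $\delta\equiv_1\delta'$ iff $\delta-q^2\delta'\in k^2$ for some $q\in k^*$. If $\mathrm{char}(k)=2$, $T\subseteq k$ is a system of representatives, with $0\in T$, for the equivalence relation on $k$: $c\equiv_2c'$ iff $c-c'=\alpha^2-\alpha$ for some $\alpha\in k$. All algebras below have $k$-basis $\{1,x,y\}$ with $1$ the unit and the following relations. With $x^2=0$: $A^0_1$: $y^2=y$, $xy=x$, $yx=0$. $A^0_2$: $y^2=y$, $xy=yx=0$. $A^0_3$: $y^2=0$, $xy=yx=0$. $A^0_4$: $y^2=x$, $xy=yx=0$. $A^0_5$: $y^2=x+y$, $xy=yx=0$. $A^0(d)$: $y^2=d\,x$, $xy=yx=0$. With $x^2=x$: $A^1_1$: $y^2=0$, $xy=yx=0$. $A^1_2$: $y^2=x-1$, $xy=yx=0$. $A^1_3$: $y^2=0$, $xy=yx=y$. $A^1_4$: $y^2=x$, $xy=yx=y$. $A^1_5$: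 $y^2=0$, $xy=y$, $yx=0$. $B_1(d)$: $y^2=d(x-1)$, $xy=yx=0$. $B_2(d)$: $y^2=d\,x$, $xy=yx=y$. $C^1_1$: $y^2=0$, $xy=yx=0$. $C^1_2(c)$: $y^2=y+c+c\,x$, $xy=yx=0$. $C^1_3$: $y^2=0$, $xy=yx=y$. $C^1_4(c)$: $y^2=y+c\,x$, $xy=yx=y$. $C^1_5$: $y^2=0$, $xy=y$, $yx=0$. $D_1(\delta)$: $y^2=\delta(x+1)$, $xy=yx=0$. $D_2(\delta)$: $y^2=\delta\,x$, $xy=yx=y$. *)

theory Defs
  imports "HOL-Analysis.Analysis"
begin

section \<open>Algebras over a field\<close>

text \<open>
  Multiplication and unit are explicit operations, as many different algebra structures on the
  one space \<open>'k^3\<close> are needed below; the zero algebra is not excluded here.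
\<close>

locale unital_algebra = vector_space scale
  for scale :: "'k::field \<Rightarrow> 'a::ab_group_add \<Rightarrow> 'a" +
  fixes mult :: "'a \<Rightarrow> 'a \<Rightarrow> 'a" and unit :: 'a
  assumes mult_assoc: "mult (mult a b) c = mult a (mult b c)"
    and mult_unit_left: "mult unit a = a"
    and mult_unit_right: "mult a unit = a"
    and mult_add_left: "mult (a + b) c = mult a c + mult b c"
    and mult_add_right: "mult a (b + c) = mult a b + mult a c"
    and mult_scale_left: "mult (scale r a) b = scale r (mult a b)"
    and mult_scale_right: "mult a (scale r b) = scale r (mult a b)"
begin

definition subalgebra :: "'a set \<Rightarrow> bool" where
  "subalgebra F \<longleftrightarrow> subspace F \<and> unit \<in> F \<and> (\<forall>a\<in>F. \<forall>b\<in>F. mult a b \<in> F)"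

definition finite_dim :: bool where
  "finite_dim \<longleftrightarrow> (\<exists>B. finite B \<and> span B = UNIV)"

text \<open>
  The chain starts at the copy \<open>span {unit}\<close> of the field, whence \<open>unit \<noteq> 0\<close>. All spaces are
  finite-dimensional, so codimension one is a statement about dimensions.
\<close>

definition supersolvable :: bool where
  "supersolvable \<longleftrightarrow> finite_dim \<and> unit \<noteq> 0 \<and>
     (\<exists>(m::nat) F. F 0 = span {unit} \<and> F m = UNIV \<and>
        (\<forall>i\<le>m. subalgebra (F i)) \<and>
        (\<forall>i<m. F i \<subseteq> F (Suc i) \<and> dim (F (Suc i)) = dim (F i) + 1))"

end

definition algebra_isomorphic ::
  "('k::field \<Rightarrow> 'a::ab_group_add \<Rightarrow> 'a) \<Rightarrow> ('a \<Rightarrow> 'a \<Rightarrow> 'a) \<Rightarrow> 'a \<Rightarrow>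
   ('k \<Rightarrow> 'b::ab_group_add \<Rightarrow> 'b) \<Rightarrow> ('b \<Rightarrow> 'b \<Rightarrow> 'b) \<Rightarrow> 'b \<Rightarrow> bool" where
  "algebra_isomorphic s1 m1 u1 s2 m2 u2 \<longleftrightarrow>
     (\<exists>f. Vector_Spaces.linear s1 s2 f \<and> bij f \<and> f u1 = u2 \<and>
          (\<forall>a b. f (m1 a b) = m2 (f a) (f b)))"


section \<open>Three-dimensional algebras given by relations\<close>

abbreviation e\<^sub>1 :: "'k::field ^ 3" where "e\<^sub>1 \<equiv> axis 1 1"
abbreviation e\<^sub>x :: "'k::field ^ 3" where "e\<^sub>x \<equiv> axis 2 1"
abbreviation e\<^sub>y :: "'k::field ^ 3" where "e\<^sub>y \<equiv> axis 3 1"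

text \<open>
  \<open>table xx yy xy yx\<close> is the bilinear multiplication on \<open>'k^3\<close> with unit \<open>e\<^sub>1\<close> and
  \<open>x\<^sup>2 = xx\<close>, \<open>y\<^sup>2 = yy\<close>, \<open>x y = xy\<close>, \<open>y x = yx\<close>, where \<open>x = e\<^sub>x\<close> and \<open>y = e\<^sub>y\<close>.
\<close>

definition table ::
  "'k::field^3 \<Rightarrow> 'k^3 \<Rightarrow> 'k^3 \<Rightarrow> 'k^3 \<Rightarrow> 'k^3 \<Rightarrow> 'k^3 \<Rightarrow> 'k^3" where
  "table xx yy xy yx a b =
     (a$1 * b$1) *s e\<^sub>1 + (a$1 * b$2 + a$2 * b$1) *s e\<^sub>x + (a$1 * b$3 + a$3 * b$1) *s e\<^sub>y
     + (a$2 * b$2) *s xx + (a$3 * b$3) *s yy + (a$2 * b$3) *s xy + (a$3 * b$2) *s yx"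

definition "A0_1 = table 0 e\<^sub>y e\<^sub>x 0"
definition "A0_2 = table 0 e\<^sub>y 0 0"
definition "A0_3 = table 0 0 0 0"
definition "A0_4 = table 0 e\<^sub>x 0 0"
definition "A0_5 = table 0 (e\<^sub>x + e\<^sub>y) 0 0"
definition "A0 d = table 0 (d *s e\<^sub>x) 0 0"

definition "A1_1 = table e\<^sub>x 0 0 0"
definition "A1_2 = table e\<^sub>x (e\<^sub>x - e\<^sub>1) 0 0"
definition "A1_3 = table e\<^sub>x 0 e\<^sub>y e\<^sub>y"
definition "A1_4 = table e\<^sub>x e\<^sub>x e\<^sub>y e\<^sub>y"
definition "A1_5 = table e\<^sub>x 0 e\<^sub>y 0"
definition "B_1 d = table e\<^sub>x (d *s (e\<^sub>x - e\<^sub>1)) 0 0"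
definition "B_2 d = table e\<^sub>x (d *s e\<^sub>x) e\<^sub>y e\<^sub>y"

definition "C1_1 = table e\<^sub>x 0 0 0"
definition "C1_2 c = table e\<^sub>x (e\<^sub>y + c *s e\<^sub>1 + c *s e\<^sub>x) 0 0"
definition "C1_3 = table e\<^sub>x 0 e\<^sub>y e\<^sub>y"
definition "C1_4 c = table e\<^sub>x (e\<^sub>y + c *s e\<^sub>x) e\<^sub>y e\<^sub>y"
definition "C1_5 = table e\<^sub>x 0 e\<^sub>y 0"
definition "D_1 \<delta> = table e\<^sub>x (\<delta> *s (e\<^sub>x + e\<^sub>1)) 0 0"
definition "D_2 \<delta> = table e\<^sub>x (\<delta> *s e\<^sub>x) e\<^sub>y e\<^sub>y"

lemmas algebra_list_defs =
  A0_1_def A0_2_def A0_3_def A0_4_def A0_5_def A0_def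
  A1_1_def A1_2_def A1_3_def A1_4_def A1_5_def B_1_def B_2_def
  C1_1_def C1_2_def C1_3_def C1_4_def C1_5_def D_1_def D_2_def

definition A0_algebras :: "('k::field^3 \<Rightarrow> 'k^3 \<Rightarrow> 'k^3) set" where
  "A0_algebras = {A0_1, A0_2, A0_3, A0_4, A0_5}"

definition A1_algebras :: "('k::field^3 \<Rightarrow> 'k^3 \<Rightarrow> 'k^3) set" where
  "A1_algebras = {A1_1, A1_2, A1_3, A1_4, A1_5}"

lemma table_basis:
  "table xx yy xy yx e\<^sub>x e\<^sub>x = xx" "table xx yy xy yx e\<^sub>y e\<^sub>y = yy"
  "table xx yy xy yx e\<^sub>x e\<^sub>y = xy" "table xx yy xy yx e\<^sub>y e\<^sub>x = yx"
  "table xx yy xy yx e\<^sub>1 a = a" "table xx yy xy yx a e\<^sub>1 = a"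
  by (simp_all add: table_def vec_eq_iff forall_3 axis_def)

lemma unital_algebra_table:
  assumes "\<And>a b c. table xx yy xy yx (table xx yy xy yx a b) c
                = table xx yy xy yx a (table xx yy xy yx b c)"
  shows "unital_algebra (*s) (table xx yy xy yx) e\<^sub>1"
  by unfold_locales
    (use assms in \<open>simp_all add: table_def vec_eq_iff forall_3 axis_def algebra_simps\<close>)

lemma unital_algebra_list:
  "unital_algebra (*s) A0_1 e\<^sub>1" "unital_algebra (*s) A0_2 e\<^sub>1" "unital_algebra (*s) A0_3 e\<^sub>1"
  "unital_algebra (*s) A0_4 e\<^sub>1" "unital_algebra (*s) A0_5 e\<^sub>1" "unital_algebra (*s) (A0 d) e\<^sub>1"
  "unital_algebra (*s) A1_1 e\<^sub>1" "unital_algebra (*s) A1_2 e\<^sub>1" "unital_algebra (*s) A1_3 e\<^sub>1"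
  "unital_algebra (*s) A1_4 e\<^sub>1" "unital_algebra (*s) A1_5 e\<^sub>1"
  "unital_algebra (*s) (B_1 d) e\<^sub>1" "unital_algebra (*s) (B_2 d) e\<^sub>1"
  "unital_algebra (*s) C1_1 e\<^sub>1" "unital_algebra (*s) C1_3 e\<^sub>1" "unital_algebra (*s) (C1_4 d) e\<^sub>1"
  "unital_algebra (*s) C1_5 e\<^sub>1" "unital_algebra (*s) (D_2 d) e\<^sub>1"
  unfolding algebra_list_defs
  by (rule unital_algebra_table; simp add: table_def vec_eq_iff forall_3 axis_def algebra_simps)+

lemma unital_algebra_list_char_2:
  fixes c :: "'k::field"
  assumes "CHAR('k) = 2"
  shows "unital_algebra (*s) (C1_2 c) e\<^sub>1" and "unital_algebra (*s) (D_1 c) e\<^sub>1"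
proof -
  have two: "(2::'k) = 0" using of_nat_CHAR[where 'a='k] assms by simp
  then have "z + z = 0" for z :: 'k by (metis mult_2 mult_zero_left)
  then have cancel: "z + (z + w) = w" "z + z = 0" for z w :: 'k
    by (simp_all flip: add.assoc)
  show "unital_algebra (*s) (C1_2 c) e\<^sub>1" "unital_algebra (*s) (D_1 c) e\<^sub>1"
    unfolding algebra_list_defs
    by (rule unital_algebra_table;
        simp add: table_def vec_eq_iff forall_3 axis_def algebra_simps cancel two)+
qed


section \<open>Systems of representatives\<close>

definition system_of_reps :: "'a set \<Rightarrow> ('a \<times> 'a) set \<Rightarrow> 'a set \<Rightarrow> bool" where
  "system_of_reps X r S \<longleftrightarrow> S \<subseteq> X \<and> (\<forall>C\<in>X // r. \<exists>!s. s \<in> S \<and> s \<in> C)"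

definition squares :: "'k::field set" where
  "squares = {q\<^sup>2 |q. True}"

definition square_rel :: "('k::field \<times> 'k) set" where
  "square_rel = {(d, d'). d \<in> - squares \<and> d' \<in> - squares \<and> (\<exists>q. q \<noteq> 0 \<and> d = q\<^sup>2 * d')}"

definition affine_square_rel :: "('k::field \<times> 'k) set" where
  "affine_square_rel =
     {(\<delta>, \<delta>'). \<delta> \<in> - squares \<and> \<delta>' \<in> - squares \<and> (\<exists>q. q \<noteq> 0 \<and> \<delta> - q\<^sup>2 * \<delta>' \<in> squares)}"

definition artin_schreier_rel :: "('k::field \<times> 'k) set" where
  "artin_schreier_rel = {(c, c'). \<exists>\<alpha>. c - c' = \<alpha>\<^sup>2 - \<alpha>}"

lemma equiv_square_rel: "equiv (- squares) (square_rel :: ('k::field \<times> 'k) set)"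
proof (intro equivI refl_onI symI transI)
  show "(square_rel :: ('k \<times> 'k) set) \<subseteq> (- squares) \<times> (- squares)"
    by (auto simp: square_rel_def)
  show "(d, d) \<in> square_rel" if "d \<in> - squares" for d :: 'k
    using that unfolding square_rel_def by (auto intro!: exI[of _ 1])
  show "(d', d) \<in> square_rel" if dd': "(d, d') \<in> square_rel" for d d' :: 'k
  proof -
    obtain q where "q \<noteq> 0" "d = q\<^sup>2 * d'" using dd' by (auto simp: square_rel_def)
    then have "d' = (inverse q)\<^sup>2 * d" "inverse q \<noteq> 0" by (auto simp: field_simps)
    then show ?thesis using dd' unfolding square_rel_def mem_Collect_eq prod.case by blast
  qed
  show "(d, d'') \<in> square_rel" if 1: "(d, d') \<in> square_rel" and 2: "(d', d'') \<in> square_rel"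
    for d d' d'' :: 'k
  proof -
    obtain p q where "p \<noteq> 0" "d = p\<^sup>2 * d'" "q \<noteq> 0" "d' = q\<^sup>2 * d''"
      using 1 2 by (auto simp: square_rel_def)
    then have "d = (p * q)\<^sup>2 * d''" "p * q \<noteq> 0" by (auto simp: power_mult_distrib)
    then show ?thesis using 1 2 unfolding square_rel_def mem_Collect_eq prod.case by blast
  qed
qed

lemma equiv_affine_square_rel:
  assumes "CHAR('k::field) = 2"
  shows "equiv (- squares) (affine_square_rel :: ('k \<times> 'k) set)"
proof (intro equivI refl_onI symI transI)
  have "(2::'k) = 0" using of_nat_CHAR[where 'a='k] assms by simp
  then have two: "z + z = 0" for z :: 'k by (metis mult_2 mult_zero_left)
  have neg: "- z = z" for z :: 'k using two[of z] by (simp add: minus_unique)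
  have sq_add: "(a + b)\<^sup>2 = a\<^sup>2 + b\<^sup>2" for a b :: 'k
    using \<open>(2::'k) = 0\<close> by (simp add: power2_sum)
  show "(affine_square_rel :: ('k \<times> 'k) set) \<subseteq> (- squares) \<times> (- squares)"
    by (auto simp: affine_square_rel_def)
  show "(d, d) \<in> affine_square_rel" if "d \<in> - squares" for d :: 'k
  proof -
    have "d - 1\<^sup>2 * d = 0\<^sup>2" by simp
    then have "d - 1\<^sup>2 * d \<in> squares" unfolding squares_def by blast
    then show ?thesis using that one_neq_zero unfolding affine_square_rel_def mem_Collect_eq prod.case by blast
  qed
  show "(d', d) \<in> affine_square_rel" if dd': "(d, d') \<in> affine_square_rel" for d d' :: 'k
  proof -
    obtain q r where qr: "q \<noteq> 0" "d - q\<^sup>2 * d' = r\<^sup>2"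
      using dd' by (auto simp: affine_square_rel_def squares_def)
    then have "d = q\<^sup>2 * d' + r\<^sup>2" by (simp add: algebra_simps)
    then have "d' - (inverse q)\<^sup>2 * d = - (r / q)\<^sup>2" using qr(1) by (simp add: field_simps)
    then have "d' - (inverse q)\<^sup>2 * d \<in> squares" unfolding neg squares_def by blast
    moreover have "inverse q \<noteq> 0" using qr(1) by simp
    ultimately show ?thesis using dd' unfolding affine_square_rel_def mem_Collect_eq prod.case by blast
  qed
  show "(d, d'') \<in> affine_square_rel"
    if 1: "(d, d') \<in> affine_square_rel" and 2: "(d', d'') \<in> affine_square_rel" for d d' d'' :: 'k
  proof -
    obtain p q r s where h: "p \<noteq> 0" "d - p\<^sup>2 * d' = r\<^sup>2" "q \<noteq> 0" "d' - q\<^sup>2 * d'' = s\<^sup>2"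
      using 1 2 by (auto simp: affine_square_rel_def squares_def)
    have "d - (p * q)\<^sup>2 * d'' = (d - p\<^sup>2 * d') + p\<^sup>2 * (d' - q\<^sup>2 * d'')"
      by (simp add: power_mult_distrib algebra_simps)
    also have "\<dots> = (r + p * s)\<^sup>2" unfolding h sq_add by (simp add: power_mult_distrib)
    finally have "d - (p * q)\<^sup>2 * d'' \<in> squares" unfolding squares_def by blast
    moreover have "p * q \<noteq> 0" using h by simp
    ultimately show ?thesis using 1 2 unfolding affine_square_rel_def mem_Collect_eq prod.case by blast
  qed
qed

lemma equiv_artin_schreier_rel:
  assumes "CHAR('k::field) = 2"
  shows "equiv UNIV (artin_schreier_rel :: ('k \<times> 'k) set)"
proof (intro equivI refl_onI symI transI)
  have t: "(2::'k) = 0" using of_nat_CHAR[where 'a='k] assms by simp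
  then have two: "z + z = 0" for z :: 'k by (metis mult_2 mult_zero_left)
  have neg: "- z = z" for z :: 'k using two[of z] by (simp add: minus_unique)
  show "(artin_schreier_rel :: ('k \<times> 'k) set) \<subseteq> UNIV \<times> UNIV" by simp
  show "(c, c) \<in> artin_schreier_rel" for c :: 'k
    unfolding artin_schreier_rel_def by (auto intro!: exI[of _ 0])
  show "(c', c) \<in> artin_schreier_rel" if "(c, c') \<in> artin_schreier_rel" for c c' :: 'k
    using that unfolding artin_schreier_rel_def by (auto simp: neg) (metis minus_diff_eq neg)
  show "(c, c'') \<in> artin_schreier_rel"
    if 1: "(c, c') \<in> artin_schreier_rel" and 2: "(c', c'') \<in> artin_schreier_rel" for c c' c'' :: 'k
  proof -
    obtain a b where h: "c - c' = a\<^sup>2 - a" "c' - c'' = b\<^sup>2 - b"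
      using 1 2 by (auto simp: artin_schreier_rel_def)
    have "c - c'' = (c - c') + (c' - c'')" by simp
    also have "\<dots> = (a + b)\<^sup>2 - (a + b)" unfolding h using t by (simp add: power2_sum)
    finally show ?thesis unfolding artin_schreier_rel_def by blast
  qed
qed

end

theory Submission
  imports Defs
begin

text \<open>
  A chain of subalgebras gives a basis \<open>1, t, y\<close> with \<open>t\<^sup>2 \<in> span {1, t}\<close>. Comparing the coefficients
  of \<open>y\<close> in \<open>t(ty) = t\<^sup>2y\<close> shows that the \<open>y\<close>-coefficient \<open>\<gamma>\<close> of \<open>ty\<close> is a root of the quadratic
  polynomial of \<open>t\<close>, so \<open>t - \<gamma>\<close> is, up to a scalar, an element \<open>x\<close> with \<open>x\<^sup>2 = 0\<close> or \<open>x\<^sup>2 = x\<close>.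
  In the first case associativity alone leads to one of the \<open>A\<^sup>0\<^sub>i\<close>. In the second case \<open>y\<close> may be
  taken to be a Peirce component with respect to \<open>x\<close>. The only family with parameters is then
  \<open>xy = yx = y\<close>, \<open>y\<^sup>2 = p x + r y\<close>, and the substitution of \<open>s y + t x\<close> for \<open>y\<close> brings \<open>p, r\<close> into
  normal form: complete the square if \<open>2 \<noteq> 0\<close>, while in characteristic 2 the case \<open>r = 0\<close> leads to
  \<open>R\<close> and the case \<open>r \<noteq> 0\<close> to \<open>T\<close>. Rescaling \<open>x\<close> makes \<open>A\<^sup>0(d)\<close>
  redundant in the list, and exchanging \<open>x\<close> and \<open>1 - x\<close> does so for \<open>B\<^sub>1(d)\<close>, \<open>C\<^sup>1\<^sub>2(c)\<close> and \<open>D\<^sub>1(\<delta>)\<close>.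
\<close>

section \<open>Bases \<open>unit, x, y\<close> and coordinates\<close>

locale algebra_dim_3 = unital_algebra scale mult unit
  for scale :: "'k::field \<Rightarrow> 'a::ab_group_add \<Rightarrow> 'a" and mult unit +
  assumes dim_3: "dim (UNIV :: 'a set) = 3"
begin

lemma mult_0_left [simp]: "mult 0 a = 0"
  using mult_scale_left[of 0 0 a] by simp

lemma mult_0_right [simp]: "mult a 0 = 0"
  using mult_scale_right[of a 0 0] by simp

lemma mult_diff_left: "mult (a - b) c = mult a c - mult b c"
  using mult_add_left[of "a - b" b c] by (simp add: algebra_simps)

lemma mult_diff_right: "mult c (a - b) = mult c a - mult c b"
  using mult_add_right[of c "a - b" b] by (simp add: algebra_simps)

lemmas mult_simps = mult_unit_left mult_unit_right mult_add_left mult_add_right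
  mult_diff_left mult_diff_right mult_scale_left mult_scale_right

lemmas scale_simps = scale_left_distrib scale_right_distrib scale_left_diff_distrib
  scale_right_diff_distrib

text \<open>The simplifier collects \<open>r + r\<close> into \<open>r * 2\<close>; these rules undo that under \<open>scale\<close>.\<close>

lemma scale_double:
  "scale (r * 2) v = scale r v + scale r v"
  "scale (r * (s * 2)) v = scale (r * s) v + scale (r * s) v"
  by (simp_all only: mult_2_right distrib_left scale_left_distrib)

text \<open>Coordinates live in \<open>'k ^ 3\<close>, the carrier of every \<open>table\<close>
  algebra; over a frame the inverse of this map is the isomorphism sought.\<close>

definition combo :: "'a \<Rightarrow> 'a \<Rightarrow> 'k ^ 3 \<Rightarrow> 'a" where
  "combo x y v = scale (v$1) unit + scale (v$2) x + scale (v$3) y"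

text \<open>Spanning is enough for a basis in dimension 3; \<open>frame_independent\<close> supplies
  the independence.\<close>

definition frame :: "'a \<Rightarrow> 'a \<Rightarrow> bool" where
  "frame x y \<longleftrightarrow> span {unit, x, y} = UNIV"

lemma combo_add: "combo x y (u + v) = combo x y u + combo x y v"
  by (simp add: combo_def scale_simps algebra_simps)

lemma combo_scale: "combo x y (r *s v) = scale r (combo x y v)"
  by (simp add: combo_def scale_simps algebra_simps)

lemma combo_axis [simp]:
  "combo x y 0 = 0" "combo x y e\<^sub>1 = unit" "combo x y e\<^sub>x = x" "combo x y e\<^sub>y = y"
  by (simp_all add: combo_def axis_def)

lemmas combo_simps = combo_add combo_scale combo_axis

lemma combo_table:
  assumes "mult x x = combo x y xx" "mult y y = combo x y yy"
    and "mult x y = combo x y xy" "mult y x = combo x y yx"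
  shows "combo x y (table xx yy xy yx a b) = mult (combo x y a) (combo x y b)"
proof -
  have "mult (combo x y a) (combo x y b) =
    scale (a$1 * b$1) unit + scale (a$1 * b$2 + a$2 * b$1) x + scale (a$1 * b$3 + a$3 * b$1) y
     + scale (a$2 * b$2) (mult x x) + scale (a$3 * b$3) (mult y y)
     + scale (a$2 * b$3) (mult x y) + scale (a$3 * b$2) (mult y x)"
    by (simp add: combo_def mult_simps scale_simps algebra_simps)
  then show ?thesis
    by (simp add: table_def combo_simps assms scale_simps)
qed

lemma frame_coords:
  assumes "frame x y"
  obtains a b c where "v = scale a unit + scale b x + scale c y"
proof -
  have "v \<in> span {unit, x, y}" using assms by (simp add: frame_def)
  then obtain a b c where "v - scale a unit - scale b x - scale c y = 0"
    by (auto simp: span_breakdown_eq)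
  then have "v = scale a unit + scale b x + scale c y"
    by (simp add: algebra_simps)
  then show thesis by (rule that)
qed

lemma frameI:
  assumes "frame x y" and "x \<in> span {unit, x', y'}" and "y \<in> span {unit, x', y'}"
  shows "frame x' y'"
proof -
  have "unit \<in> span {unit, x', y'}" by (simp add: span_base)
  with assms have "span {unit, x, y} \<subseteq> span {unit, x', y'}"
    by (intro span_minimal) auto
  with assms show ?thesis by (auto simp: frame_def)
qed

lemma span_3_I: "v = scale a unit + scale b x + scale c y \<Longrightarrow> v \<in> span {unit, x, y}"
  by (simp add: span_add span_scale span_base)

lemma span_neq_UNIV_if_card_2:
  "span {u, v} \<noteq> UNIV"
proof
  assume "span {u, v} = UNIV"
  then have "dim UNIV = dim {u, v}" using dim_span by metis
  also have "\<dots> \<le> card {u, v}" by (rule dim_le_card') simp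
  also have "\<dots> \<le> 2" by (simp add: card_insert_if)
  finally show False using dim_3 by simp
qed

text \<open>A nonzero coefficient would make its vector redundant, and two vectors cannot span
  dimension 3.\<close>

lemma frame_independent:
  assumes fr: "frame x y" and z: "scale a unit + scale b x + scale c y = 0"
  shows "a = 0 \<and> b = 0 \<and> c = 0"
proof -
  have key: "r = 0" if "scale r u + scale s v + scale t w = 0" "{unit, x, y} = {u, v, w}"
    for r s t u v w
  proof (rule ccontr)
    assume r: "r \<noteq> 0"
    from that have "scale r u = - (scale s v + scale t w)"
      by (simp add: add_eq_0_iff2 add.assoc)
    also have "\<dots> \<in> span {v, w}"
      by (intro span_neg span_add span_scale span_base) auto
    finally have "scale (inverse r) (scale r u) \<in> span {v, w}"
      by (rule span_scale)
    then have "u \<in> span {v, w}" using r by simp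
    then have "span {u, v, w} = span {v, w}"
      by (simp add: span_redundant)
    with fr that(2) span_neq_UNIV_if_card_2 show False
      by (simp add: frame_def)
  qed
  have "a = 0" using key[OF z] by simp
  moreover have "b = 0" by (rule key[of b x a unit c y]) (use z in \<open>auto simp: algebra_simps\<close>)
  moreover have "c = 0" by (rule key[of c y a unit b x]) (use z in \<open>auto simp: algebra_simps\<close>)
  ultimately show ?thesis by simp
qed

lemma frame_coords_eq:
  assumes "frame x y"
    and "scale a unit + scale b x + scale c y = scale a' unit + scale b' x + scale c' y"
  shows "a = a'" "b = b'" "c = c'"
proof -
  have "scale (a - a') unit + scale (b - b') x + scale (c - c') y = 0"
    using assms(2) by (simp add: scale_simps algebra_simps)
  from frame_independent[OF assms(1) this] show "a = a'" "b = b'" "c = c'" by auto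
qed

lemma bij_combo:
  assumes "frame x y"
  shows "bij (combo x y)"
proof (rule bijI)
  show "inj (combo x y)"
    using frame_coords_eq[OF assms] by (auto intro!: injI simp: combo_def vec_eq_iff forall_3)
  have "v \<in> range (combo x y)" for v
  proof -
    obtain a b c where "v = scale a unit + scale b x + scale c y"
      using frame_coords[OF assms] .
    then have "v = combo x y (vector [a, b, c])" by (simp add: combo_def vector_3)
    then show ?thesis by blast
  qed
  then show "surj (combo x y)" by blast
qed

abbreviation isomorphic_to :: "('k^3 \<Rightarrow> 'k^3 \<Rightarrow> 'k^3) \<Rightarrow> bool" where
  "isomorphic_to M \<equiv> algebra_isomorphic scale mult unit (*s) M e\<^sub>1"

text \<open>Every isomorphism below comes from here: it remains to find a frame with the right four
  products.\<close>

lemma isomorphic_table: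
  assumes fr: "frame x y"
    and "mult x x = combo x y xx" "mult y y = combo x y yy"
    and "mult x y = combo x y xy" "mult y x = combo x y yx"
  shows "isomorphic_to (table xx yy xy yx)"
proof -
  define f where "f = inv (combo x y)"
  have inj: "inj (combo x y)" and surj: "surj (combo x y)"
    using bij_combo[OF fr] by (auto simp: bij_def)
  have gf: "combo x y (f v) = v" for v
    unfolding f_def using surj by (rule surj_f_inv_f)
  have fI: "f v = w" if "v = combo x y w" for v w
    using that inj by (simp add: f_def)
  have "Vector_Spaces.linear scale (*s) f"
    unfolding Vector_Spaces.linear_iff
    by (intro conjI allI vector_space_axioms vec.vector_space_axioms)
      (auto intro!: fI simp: combo_simps gf)
  moreover have "bij f" unfolding f_def using bij_combo[OF fr] by (rule bij_imp_bij_inv)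
  moreover have "f unit = e\<^sub>1" by (rule fI) simp
  moreover have "f (mult a b) = table xx yy xy yx (f a) (f b)" for a b
    by (rule fI) (simp add: combo_table[OF assms(2-)] gf)
  ultimately show ?thesis unfolding algebra_isomorphic_def by blast
qed


section \<open>The case \<open>x\<^sup>2 = 0\<close>\<close>

lemma frame_square_zero:
  assumes fr: "frame x y0" and xx: "mult x x = 0"
  shows "\<exists>M \<in> A0_algebras. isomorphic_to M"
proof -
  obtain a where xy0: "mult x y0 = scale a x"
  proof -
    obtain a1 a2 a3 where e: "mult x y0 = scale a1 unit + scale a2 x + scale a3 y0"
      using frame_coords[OF fr] .
    \<comment> \<open>In \<open>x (x y0)\<close> the coefficient of \<open>y0\<close> is
      \<open>a3 * a3\<close>; once \<open>a3 = 0\<close>, that of \<open>x\<close> is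
      \<open>a1\<close>.\<close>
    have "mult x (mult x y0) = 0" using mult_assoc[of x x y0] xx by simp
    then have "scale (a3 * a1) unit + scale (a1 + a3 * a2) x + scale (a3 * a3) y0 = 0"
      by (simp add: e mult_simps xx scale_simps algebra_simps)
    from frame_independent[OF fr this] have "a3 = 0" "a1 = 0" by auto
    with e that[of a2] show thesis by simp
  qed
  obtain b where y0x: "mult y0 x = scale b x"
  proof -
    obtain a1 a2 a3 where e: "mult y0 x = scale a1 unit + scale a2 x + scale a3 y0"
      using frame_coords[OF fr] .
    have "mult (mult y0 x) x = 0" using mult_assoc[of y0 x x] xx by simp
    then have "scale (a3 * a1) unit + scale (a1 + a3 * a2) x + scale (a3 * a3) y0 = 0"
      by (simp add: e mult_simps xx scale_simps algebra_simps)
    from frame_independent[OF fr this] have "a3 = 0" "a1 = 0" by auto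
    with e that[of a2] show thesis by simp
  qed
  \<comment> \<open>Subtracting \<open>b\<close> kills \<open>y x\<close> and leaves
    \<open>x y = (a - b) x\<close>.\<close>
  define y c where "y = y0 - scale b unit" and "c = a - b"
  have yx: "mult y x = 0" and xy: "mult x y = scale c x"
    by (simp_all add: y_def c_def mult_simps xy0 y0x scale_simps)
  have "frame x y"
    by (rule frameI[OF fr]; rule span_3_I[of _ 0 1 _ 0] span_3_I[of _ b 0 _ 1])
      (simp_all add: y_def)
  note fr = this
  obtain p q r where yy: "mult y y = scale p unit + scale q x + scale r y"
    using frame_coords[OF fr] .
  \<comment> \<open>Associativity of the triples \<open>y y x\<close>, \<open>x y y\<close>,
    \<open>y y y\<close> yields in turn \<open>p = 0\<close>, \<open>c (r - c) = 0\<close> and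
    \<open>q c = 0\<close>.\<close>
  have "mult (mult y y) x = 0" using mult_assoc[of y y x] yx by simp
  then have "scale 0 unit + scale p x + scale 0 y = 0"
    by (simp add: yy mult_simps xx yx)
  from frame_independent[OF fr this] have p: "p = 0" by auto
  have "mult x (mult y y) = scale (c * c) x"
    using mult_assoc[of x y y] by (simp add: xy mult_simps)
  then have "scale 0 unit + scale (r * c - c * c) x + scale 0 y = 0"
    by (simp add: yy p mult_simps xx xy scale_simps)
  from frame_independent[OF fr this] have rc: "c = 0 \<or> r = c" by auto
  have "mult (mult y y) y = mult y (mult y y)" by (rule mult_assoc)
  then have "scale 0 unit + scale (q * c) x + scale 0 y = 0"
    by (simp add: yy p mult_simps xy yx)
  from frame_independent[OF fr this] have qc: "q = 0 \<or> c = 0" by auto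
  have frame_scale: "frame (scale s x) (scale t y)" if "s \<noteq> 0" "t \<noteq> 0" for s t
    by (rule frameI[OF fr];
        rule span_3_I[of _ 0 "inverse s" _ 0] span_3_I[of _ 0 0 _ "inverse t"])
      (use that in simp_all)
  \<comment> \<open>If \<open>c \<noteq> 0\<close>, the relations force \<open>r = c\<close> and
    \<open>q = 0\<close>, so no further split is needed there.\<close>
  consider "c \<noteq> 0" | "c = 0" "r \<noteq> 0" "q = 0" | "c = 0" "r \<noteq> 0" "q \<noteq> 0"
    | "c = 0" "r = 0" "q = 0" | "c = 0" "r = 0" "q \<noteq> 0" by blast
  then show ?thesis
  proof cases
    case 1
    then have "isomorphic_to A0_1" unfolding A0_1_def using rc qc
      by (intro isomorphic_table[OF frame_scale[of 1 "inverse c"]])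
        (simp_all add: combo_simps mult_simps xx xy yx yy p)
    then show ?thesis by (auto simp: A0_algebras_def)
  next
    case 2
    then have "isomorphic_to A0_2" unfolding A0_2_def
      by (intro isomorphic_table[OF frame_scale[of 1 "inverse r"]])
        (simp_all add: combo_simps mult_simps xx xy yx yy p)
    then show ?thesis by (auto simp: A0_algebras_def)
  next
    case 3
    \<comment> \<open>For \<open>Y = y / r\<close> one has
      \<open>Y\<^sup>2 = (q / r\<^sup>2) x + Y\<close>, so \<open>(q / r\<^sup>2) x\<close> becomes
      the new \<open>x\<close>.\<close>
    then have "isomorphic_to A0_5" unfolding A0_5_def
      by (intro isomorphic_table[OF frame_scale[of "q * inverse r * inverse r" "inverse r"]])
        (simp_all add: combo_simps mult_simps xx xy yx yy p scale_simps ac_simps)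
    then show ?thesis by (auto simp: A0_algebras_def)
  next
    case 4
    then have "isomorphic_to A0_3" unfolding A0_3_def
      by (intro isomorphic_table[OF fr])
        (simp_all add: combo_simps mult_simps xx xy yx yy p)
    then show ?thesis by (auto simp: A0_algebras_def)
  next
    case 5
    then have "isomorphic_to A0_4" unfolding A0_4_def
      by (intro isomorphic_table[OF frame_scale[of q 1]])
        (simp_all add: combo_simps mult_simps xx xy yx yy p)
    then show ?thesis by (auto simp: A0_algebras_def)
  qed
qed

section \<open>The case \<open>x\<^sup>2 = x\<close>: Peirce components\<close>

lemma frame_replace:
  assumes fr: "frame x y" and "z \<notin> span {unit, x}"
  shows "frame x z"
proof -
  obtain a b c where z: "z = scale a unit + scale b x + scale c y"
    using frame_coords[OF fr] .
  have "c \<noteq> 0"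
  proof
    assume "c = 0"
    then have "z \<in> span {unit, x}" using z by (simp add: span_add span_scale span_base)
    with assms show False by simp
  qed
  then have "y = scale (inverse c * - a) unit + scale (inverse c * - b) x + scale (inverse c) z"
    by (simp add: z scale_simps)
  then show ?thesis
    by (intro frameI[OF fr] span_3_I[of x 0 1 x 0 z] span_3_I[of y]) (simp, assumption)
qed

lemma frame_complement:
  assumes "frame x y"
  shows "frame (unit - x) y"
  by (rule frameI[OF assms]; rule span_3_I[of _ 1 "- 1" _ 0] span_3_I[of _ 0 0 _ 1])
    (simp_all add: scale_simps)

text \<open>
  Some Peirce component \<open>z\<close> of \<open>y\<close> still completes \<open>unit, x\<close> to a basis; exchanging \<open>x\<close> and
  \<open>unit - x\<close> leaves only the components \<open>z = xz(unit - x)\<close> and \<open>z = xzx\<close>.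
\<close>

lemma frame_idempotent:
  assumes fr: "frame x y" and xx: "mult x x = x"
  obtains (nilpotent) x z where "frame x z" "mult x x = x" "mult x z = z" "mult z x = 0" "mult z z = 0"
  | (unital) x z p r where "frame x z" "mult x x = x" "mult x z = z" "mult z x = z"
      "mult z z = scale p x + scale r z"
proof -
  have off_diagonal: thesis
    if fr: "frame x z" and xx: "mult x x = x" and xz: "mult x z = z" and zx: "mult z x = 0" for x z
  proof -
    \<comment> \<open>\<open>(z x) z = z (x z)\<close> reads \<open>0 = z z\<close>.\<close>
    have "mult z z = 0" using mult_assoc[of z x z] by (simp add: xz zx)
    with that show thesis by (rule nilpotent)
  qed
  have diagonal: thesis
    if fr: "frame x z" and xx: "mult x x = x" and xz: "mult x z = z" and zx: "mult z x = z" for x z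
  proof -
    obtain p q r where zz: "mult z z = scale p unit + scale q x + scale r z"
      using frame_coords[OF fr] .
    \<comment> \<open>As \<open>x z = z\<close>, left multiplication by \<open>x\<close> fixes
      \<open>z z\<close>; it turns the term in \<open>unit\<close> into one in
      \<open>x\<close>.\<close>
    have "mult z z = mult x (mult z z)" using mult_assoc[of x z z] by (simp add: xz)
    also have "\<dots> = scale (p + q) x + scale r z"
      by (simp add: zz mult_simps xx xz scale_simps)
    finally show thesis by (rule unital[OF that])
  qed
  have absorb: "mult x (mult x a) = mult x a" for a
    using mult_assoc[of x x a] xx by simp
  define e where "e = unit - x"
  have ee: "mult e e = e" and xe: "mult x e = 0" and ex: "mult e x = 0"
    by (simp_all add: e_def mult_simps xx)
  define y11 y10 y01 y00 where "y11 = mult x (mult y x)" and "y10 = mult x (mult y e)"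
    and "y01 = mult e (mult y x)" and "y00 = mult e (mult y e)"
  have y: "y = y11 + y10 + y01 + y00"
    by (simp add: y11_def y10_def y01_def y00_def e_def mult_simps)
  have "y \<notin> span {unit, x}"
  proof
    assume "y \<in> span {unit, x}"
    then have "span {unit, x} = UNIV"
      using fr span_redundant[of y "{unit, x}"] by (simp add: frame_def insert_commute)
    then show False using span_neq_UNIV_if_card_2 by blast
  qed
  \<comment> \<open>Were all four components in \<open>span {unit, x}\<close>, so would be their sum
    \<open>y\<close>.\<close>
  then consider "y11 \<notin> span {unit, x}" | "y10 \<notin> span {unit, x}"
    | "y01 \<notin> span {unit, x}" | "y00 \<notin> span {unit, x}"
    using span_add[of "y11 + y10 + y01" _ y00] span_add[of "y11 + y10" _ y01] span_add[of y11 _ y10] y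
    by metis
  then show thesis
  proof cases
    case 1
    show thesis
      by (rule diagonal[OF frame_replace[OF fr 1] xx])
        (simp_all add: y11_def mult_assoc absorb xx)
  next
    case 2
    show thesis
      by (rule off_diagonal[OF frame_replace[OF fr 2] xx])
        (simp_all add: y10_def mult_assoc absorb ex)
  next
    case 3
    have "frame e y01"
      unfolding e_def by (rule frame_complement[OF frame_replace[OF fr 3]])
    then show thesis
      by (rule off_diagonal[OF _ ee])
        (simp_all add: y01_def mult_assoc xe, simp_all add: mult_assoc[symmetric] ee)
  next
    case 4
    have "frame e y00"
      unfolding e_def by (rule frame_complement[OF frame_replace[OF fr 4]])
    then show thesis
      by (rule diagonal[OF _ ee])
        (simp_all add: y00_def mult_assoc ee, simp_all add: mult_assoc[symmetric] ee)
  qed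
qed

section \<open>From the chain to \<open>x\<^sup>2 = 0\<close> or
  \<open>x\<^sup>2 = x\<close>\<close>

lemma supersolvable_frame:
  assumes "supersolvable"
  obtains x y where "frame x y" "mult x x = 0"
  | x y where "frame x y" "mult x x = x"
proof -
  have unit: "unit \<noteq> 0" using assms by (simp add: supersolvable_def)
  obtain B where B: "finite B" "span B = UNIV"
    using assms by (auto simp: supersolvable_def finite_dim_def)
  obtain m F where chain: "F 0 = span {unit} \<and> F m = UNIV \<and> (\<forall>i\<le>m. subalgebra (F i)) \<and>
      (\<forall>i<m. F i \<subseteq> F (Suc i) \<and> dim (F (Suc i)) = dim (F i) + 1)"
    using assms unfolding supersolvable_def by (elim conjE exE) (rule that, simp)
  then have F0: "F 0 = span {unit}" and Fm: "F m = UNIV"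
    by simp_all
  obtain B' where B': "B' \<subseteq> B" "independent B'" "B \<subseteq> span B'"
    using maximal_independent_subset[of B] by blast
  then have "span B' = UNIV"
    using B(2) span_minimal[OF B'(3)] by auto
  interpret fd: finite_dimensional_vector_space scale B'
    by unfold_locales (use B(1) B' \<open>span B' = UNIV\<close> finite_subset in auto)
  have dF0: "dim (F 0) = 1"
    using unit by (simp add: F0 dim_span dim_eq_card_independent)
  have "m \<noteq> 0"
  proof
    assume "m = 0"
    then show False using Fm dF0 dim_3 by simp
  qed
  then have F1: "subalgebra (F 1)" "F 0 \<subseteq> F 1" "dim (F 1) = 2"
    using chain[THEN conjunct2, THEN conjunct2] dF0 by auto
  \<comment> \<open>The basis is adapted to the chain: \<open>unit, t\<close> span the plane
    \<open>F 1\<close>, and \<open>y\<close> lies outside it.\<close>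
  obtain t where t: "t \<in> F 1" "t \<notin> span {unit}"
  proof -
    have "F 1 \<noteq> F 0" using F1(3) dF0 by auto
    then show thesis using F1(2) F0 that by blast
  qed
  obtain y where y: "y \<notin> F 1"
  proof -
    have "F 1 \<noteq> UNIV" using F1(3) dim_3 by auto
    then show thesis using that by blast
  qed
  have "span {unit, t} \<subseteq> F 1"
    using F1(1) t by (intro span_minimal) (auto simp: subalgebra_def)
  then have ynot: "y \<notin> span {unit, t}" using y by blast
  have ind: "independent {unit, t, y}"
  proof -
    have "independent {t, unit}"
      using unit t(2) by (simp add: independent_insert)
    then have "independent {y, t, unit}"
      using ynot by (intro independent_insertI[of y "{t, unit}"]) (simp_all add: insert_commute)
    then show ?thesis by (simp add: insert_commute)
  qed
  moreover have "card {unit, t, y} = 3"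
    using t ynot by (auto simp: card_insert_if span_base)
  ultimately have "UNIV \<subseteq> span {unit, t, y}"
    using dim_3 by (intro fd.card_ge_dim_independent) auto
  then have fr: "frame t y" by (auto simp: frame_def)
  obtain a b where tt: "mult t t = scale a unit + scale b t"
  proof -
    obtain a b c where e: "mult t t = scale a unit + scale b t + scale c y"
      using frame_coords[OF fr] .
    have sb: "subspace (F 1)" "unit \<in> F 1" "mult t t \<in> F 1"
      using F1(1) t by (auto simp: subalgebra_def)
    \<comment> \<open>\<open>F 1\<close> contains \<open>t\<^sup>2\<close>, so a nonzero term in
      \<open>y\<close> would put \<open>y\<close> into \<open>F 1\<close>.\<close>
    have "c = 0"
    proof (rule ccontr)
      assume "c \<noteq> 0"
      then have "y = scale (inverse c) (mult t t - (scale a unit + scale b t))"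
        by (simp add: e)
      also have "\<dots> \<in> F 1"
        by (intro subspace_scale subspace_diff subspace_add sb t)
      finally show False using y by simp
    qed
    with e that[of a b] show thesis by simp
  qed
  obtain \<alpha> \<beta> \<gamma> where ty: "mult t y = scale \<alpha> unit + scale \<beta> t + scale \<gamma> y"
    using frame_coords[OF fr] .
  have "mult t (mult t y) = mult (mult t t) y" by (simp add: mult_assoc)
  then have "scale (\<beta> * a + \<gamma> * \<alpha>) unit + scale (\<alpha> + \<beta> * b + \<gamma> * \<beta>) t + scale (\<gamma> * \<gamma>) y
    = scale (b * \<alpha>) unit + scale (b * \<beta>) t + scale (a + b * \<gamma>) y"
    by (simp add: ty tt mult_simps scale_simps algebra_simps)
  from frame_coords_eq(3)[OF fr this] have root: "a = \<gamma> * \<gamma> - b * \<gamma>" by (simp add: algebra_simps)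
  \<comment> \<open>The polynomial of \<open>t\<close> has the roots \<open>\<gamma>\<close> and
    \<open>b - \<gamma>\<close>; after the shift they are \<open>0\<close> and
    \<open>b - \<gamma> - \<gamma>\<close>.\<close>
  define u where "u = t - scale \<gamma> unit"
  have uu: "mult u u = scale (b - \<gamma> - \<gamma>) u"
    by (simp add: u_def mult_simps tt root scale_simps scale_double algebra_simps)
  have fru: "frame (scale s u) y" if "s \<noteq> 0" for s
    by (rule frameI[OF fr]; rule span_3_I[of _ \<gamma> "inverse s" _ 0] span_3_I[of _ 0 0 _ 1])
      (use that in \<open>simp_all add: u_def\<close>)
  \<comment> \<open>A double root gives \<open>u\<^sup>2 = 0\<close>; otherwise dividing
    \<open>u\<close> by the difference of the roots makes it idempotent.\<close>
  show thesis
  proof (cases "b - \<gamma> - \<gamma> = 0")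
    case True
    then show thesis using that(1)[OF fru[of 1]] uu by simp
  next
    case False
    then show thesis using that(2)[OF fru[of "inverse (b - \<gamma> - \<gamma>)"]] uu
      by (simp add: mult_simps)
  qed
qed

section \<open>Substitution in \<open>z\<^sup>2 = p x + r z\<close>\<close>

text \<open>For \<open>y = s z + t x\<close> the square is
  \<open>(s\<^sup>2 p + t\<^sup>2) x + (s r + 2 t) s z\<close>, and \<open>s z = y - t x\<close>
  turns this into \<open>p' x + r' y\<close>.\<close>

lemma isomorphic_unital_corner:
  assumes fr: "frame x z" and xx: "mult x x = x" and xz: "mult x z = z" and zx: "mult z x = z"
    and zz: "mult z z = scale p x + scale r z"
    and s: "s \<noteq> 0" and r': "s * r + 2 * t = r'" and p': "s\<^sup>2 * p + t\<^sup>2 = p' + r' * t"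
  shows "isomorphic_to (table e\<^sub>x (p' *s e\<^sub>x + r' *s e\<^sub>y) e\<^sub>y e\<^sub>y)"
proof -
  define y where "y = scale s z + scale t x"
  have "z = scale 0 unit + scale (- (inverse s * t)) x + scale (inverse s) y"
    using s by (simp add: y_def scale_simps)
  then have "frame x y"
    by (intro frameI[OF fr] span_3_I[of x 0 1 x 0 y] span_3_I[of z]) (simp, assumption)
  moreover have "mult y y = scale p' x + scale r' y"
  proof -
    have "mult y y = scale (s\<^sup>2 * p + t\<^sup>2) x + scale (s * (s * r + (t + t))) z"
      by (simp add: y_def mult_simps scale_simps xx xz zx zz power2_eq_square
          scale_double algebra_simps)
    also have "\<dots> = scale p' x + scale r' y"
      unfolding mult_2[symmetric] r' p' by (simp add: y_def scale_simps algebra_simps)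
    finally show ?thesis .
  qed
  moreover have "mult x y = y" "mult y x = y"
    by (simp_all add: y_def mult_simps xx xz zx)
  ultimately show ?thesis
    by (intro isomorphic_table) (simp_all add: combo_simps xx)
qed

end

section \<open>Representatives and the four cases\<close>

lemma system_of_reps_obtain:
  assumes "system_of_reps X r S" and "equiv X r" and "a \<in> X"
  obtains s where "s \<in> S" "(a, s) \<in> r"
proof -
  have "r `` {a} \<in> X // r" using assms(3) by (rule quotientI)
  with assms(1) obtain s where "s \<in> S" "s \<in> r `` {a}"
    unfolding system_of_reps_def by blast
  with that show thesis by blast
qed

theorem theorem3p11:
  fixes scale :: "'k::field \<Rightarrow> 'a::ab_group_add \<Rightarrow> 'a"
    and mult :: "'a \<Rightarrow> 'a \<Rightarrow> 'a" and unit :: 'a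
    and S R T :: "'k set"
  assumes S: "squares \<noteq> (UNIV :: 'k set) \<Longrightarrow> system_of_reps (- squares) square_rel S"
    and R: "CHAR('k) = 2 \<Longrightarrow> squares \<noteq> (UNIV :: 'k set) \<Longrightarrow>
              system_of_reps (- squares) affine_square_rel R"
    and T: "CHAR('k) = 2 \<Longrightarrow> system_of_reps UNIV artin_schreier_rel T \<and> 0 \<in> T"
    and alg: "unital_algebra scale mult unit"
    and dim3: "vector_space.dim scale (UNIV :: 'a set) = 3"
    and ss: "unital_algebra.supersolvable scale mult unit"
  shows
    "(CHAR('k) \<noteq> 2 \<and> squares = (UNIV :: 'k set) \<longrightarrow>
        (\<exists>M \<in> A0_algebras \<union> A1_algebras.
           algebra_isomorphic scale mult unit (*s) M e\<^sub>1)) \<and>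
     (CHAR('k) \<noteq> 2 \<and> squares \<noteq> (UNIV :: 'k set) \<longrightarrow>
        (\<exists>M \<in> A0_algebras \<union> A1_algebras \<union> A0 ` S \<union> B_1 ` S \<union> B_2 ` S.
           algebra_isomorphic scale mult unit (*s) M e\<^sub>1)) \<and>
     (CHAR('k) = 2 \<and> squares = (UNIV :: 'k set) \<longrightarrow>
        (\<exists>M \<in> A0_algebras \<union> {C1_1, C1_3, C1_5} \<union> C1_2 ` T \<union> C1_4 ` T.
           algebra_isomorphic scale mult unit (*s) M e\<^sub>1)) \<and>
     (CHAR('k) = 2 \<and> squares \<noteq> (UNIV :: 'k set) \<longrightarrow>
        (\<exists>M \<in> A0_algebras \<union> A0 ` S \<union> {C1_1, C1_3, C1_5} \<union> C1_2 ` T \<union> C1_4 ` T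
               \<union> D_1 ` R \<union> D_2 ` R.
           algebra_isomorphic scale mult unit (*s) M e\<^sub>1))"
proof -
  interpret unital_algebra scale mult unit by (rule alg)
  interpret algebra_dim_3 scale mult unit by unfold_locales (rule dim3)
  have C1: "C1_3 = (A1_3 :: 'k^3 \<Rightarrow> _)" "C1_5 = (A1_5 :: 'k^3 \<Rightarrow> _)"
    by (simp_all add: algebra_list_defs)
  \<comment> \<open>One disjunction serves all four cases: \<open>A1_3\<close> and
    \<open>A1_5\<close> are also \<open>C1_3\<close> and \<open>C1_5\<close>, and branches with
    nonsquare parameters record \<open>squares \<noteq> UNIV\<close>.\<close>
  have "(\<exists>M \<in> A0_algebras. isomorphic_to M) \<or> isomorphic_to A1_5 \<or> isomorphic_to A1_3
    \<or> (CHAR('k) \<noteq> 2 \<and> (isomorphic_to A1_4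
          \<or> squares \<noteq> (UNIV :: 'k set) \<and> (\<exists>d\<in>S. isomorphic_to (B_2 d))))
    \<or> (CHAR('k) = 2 \<and> ((\<exists>c\<in>T. isomorphic_to (C1_4 c))
          \<or> squares \<noteq> (UNIV :: 'k set) \<and> (\<exists>\<delta>\<in>R. isomorphic_to (D_2 \<delta>))))"
    (is "?nil \<or> ?rest")
    using ss
  proof (cases rule: supersolvable_frame)
    case (1 x y)
    then have ?nil by (rule frame_square_zero)
    then show ?thesis ..
  next
    case (2 x y)
    then show ?thesis
    proof (cases rule: frame_idempotent)
      case (nilpotent x z)
      then have "isomorphic_to A1_5" unfolding A1_5_def
        by (intro isomorphic_table) (simp_all add: combo_simps)
      then show ?thesis by blast
    next
      case (unital x z p r)
      note iso = isomorphic_unital_corner[OF unital]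
      show ?thesis
      proof (cases "CHAR('k) = 2")
        case False
        have two: "(2::'k) \<noteq> 0"
        proof
          assume "(2::'k) = 0"
          then have "of_nat 2 = (0::'k)" by simp
          then have "CHAR('k) dvd 2" by (simp only: of_nat_eq_0_iff_char_dvd)
          then show False using False CHAR_not_1' two_is_prime_nat
            by (metis One_nat_def prime_nat_iff)
        qed
        \<comment> \<open>Completing the square:
          \<open>(z - (r / 2) x)\<^sup>2 = \<Delta> x\<close>. Scaling by \<open>s\<close>
          multiplies \<open>\<Delta>\<close> by \<open>s\<^sup>2\<close>, whence
          \<open>square_rel\<close>.\<close>
        define \<Delta> where "\<Delta> = p + (r / 2)\<^sup>2"
        have iso': "isomorphic_to (B_2 d)" if "s \<noteq> 0" "s\<^sup>2 * \<Delta> = d" for s d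
        proof -
          have "isomorphic_to (table e\<^sub>x (d *s e\<^sub>x + 0 *s e\<^sub>y) e\<^sub>y e\<^sub>y)"
            by (rule iso[OF that(1), of "- (s * r / 2)"])
              (use two that(2) in \<open>simp_all add: \<Delta>_def power_mult_distrib power_divide algebra_simps\<close>)
          then show ?thesis by (simp add: B_2_def)
        qed
        show ?thesis
        proof (cases "\<Delta> \<in> squares")
          case True
          then obtain q where q: "\<Delta> = q\<^sup>2" by (auto simp: squares_def)
          \<comment> \<open>\<open>B_2 0\<close> is \<open>A1_3\<close> and \<open>B_2 1\<close> is
            \<open>A1_4\<close>.\<close>
          show ?thesis
          proof (cases "q = 0")
            case True
            then have "isomorphic_to (B_2 0)" using iso'[of 1] q by simp
            then show ?thesis by (simp add: B_2_def A1_3_def)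
          next
            case False
            then have "isomorphic_to (B_2 1)" using iso'[of "inverse q"] q
              by (simp add: power_inverse)
            then show ?thesis using \<open>CHAR('k) \<noteq> 2\<close> by (simp add: B_2_def A1_4_def)
          qed
        next
          case False
          then have reps: "system_of_reps (- squares) square_rel S" using S by blast
          obtain d where "d \<in> S" "(\<Delta>, d) \<in> square_rel"
            using system_of_reps_obtain[OF reps equiv_square_rel iffD2[OF Compl_iff False]] .
          then obtain q where "q \<noteq> 0" "\<Delta> = q\<^sup>2 * d" by (auto simp: square_rel_def)
          then have "isomorphic_to (B_2 d)"
            by (intro iso'[of "inverse q"]) (simp_all add: power_inverse)
          then show ?thesis using \<open>CHAR('k) \<noteq> 2\<close> \<open>d \<in> S\<close> False by blast
        qed
      next
        case char: True
        then have two: "(2::'k) = 0" using of_nat_CHAR[where 'a='k] by simp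
        have dbl: "a + a = 0" for a :: 'k using two by (metis mult_2 mult_zero_left)
        have neg: "- a = a" for a :: 'k using dbl[of a] by (simp add: minus_unique)
        have minus: "a - b = a + b" for a b :: 'k
          by (simp only: diff_conv_add_uminus neg)
        show ?thesis
        proof (cases "r = 0")
          case False
          \<comment> \<open>Since \<open>2 t = 0\<close>, taking \<open>s = 1 / r\<close> gives
            \<open>r' = 1\<close> and \<open>p' = p / r\<^sup>2 + t\<^sup>2 - t\<close>: varying
            \<open>t\<close> realises the Artin-Schreier relation.\<close>
          obtain c where "c \<in> T" "(p / r\<^sup>2, c) \<in> artin_schreier_rel"
            using system_of_reps_obtain[OF conjunct1[OF T[OF char]]
                equiv_artin_schreier_rel[OF char] UNIV_I] .
          then obtain t where "p / r\<^sup>2 - c = t\<^sup>2 - t"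
            unfolding artin_schreier_rel_def by blast
          then have t: "p / r\<^sup>2 + c = t\<^sup>2 + t"
            by (simp only: minus)
          have "p / r\<^sup>2 + t\<^sup>2 = p / r\<^sup>2 + (t\<^sup>2 + t) + t"
            by (simp add: add.assoc dbl)
          also have "\<dots> = (p / r\<^sup>2 + p / r\<^sup>2) + c + t"
            by (simp only: t[symmetric] add.assoc)
          finally have "p / r\<^sup>2 + t\<^sup>2 = c + t"
            by (simp only: dbl add_0_left)
          then have "isomorphic_to (table e\<^sub>x (c *s e\<^sub>x + 1 *s e\<^sub>y) e\<^sub>y e\<^sub>y)"
            using False by (intro iso[of "inverse r" t]) (simp_all add: two field_simps)
          then have "isomorphic_to (C1_4 c)" by (simp add: C1_4_def add.commute)
          then show ?thesis using char \<open>c \<in> T\<close> by blast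
        next
          case r: True
          \<comment> \<open>Now \<open>r' = 0\<close> for all \<open>s, t\<close>, while
            \<open>p' = s\<^sup>2 p + t\<^sup>2\<close>; this is the freedom in
            \<open>affine_square_rel\<close>.\<close>
          have iso': "isomorphic_to (D_2 d)" if "s \<noteq> 0" "s\<^sup>2 * p + t\<^sup>2 = d" for s t d
          proof -
            have "isomorphic_to (table e\<^sub>x (d *s e\<^sub>x + 0 *s e\<^sub>y) e\<^sub>y e\<^sub>y)"
              by (rule iso[OF that(1), of t]) (use that(2) in \<open>simp_all add: r two\<close>)
            then show ?thesis by (simp add: D_2_def)
          qed
          show ?thesis
          proof (cases "p \<in> squares")
            case True
            then obtain q where "p = q\<^sup>2" by (auto simp: squares_def)
            \<comment> \<open>With \<open>t = q\<close> the coefficient is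
              \<open>q\<^sup>2 + q\<^sup>2 = 0\<close>.\<close>
            then have "isomorphic_to (D_2 0)" using iso'[of 1 q] by (simp add: dbl)
            then show ?thesis by (simp add: D_2_def A1_3_def)
          next
            case False
            then have reps: "system_of_reps (- squares) affine_square_rel R" using R[OF char] by blast
            obtain d where "d \<in> R" "(p, d) \<in> affine_square_rel"
              using system_of_reps_obtain[OF reps equiv_affine_square_rel[OF char] iffD2[OF Compl_iff False]] .
            then obtain q w where q: "q \<noteq> 0" and "p - q\<^sup>2 * d = w\<^sup>2"
              unfolding affine_square_rel_def squares_def by blast
            then have w: "w\<^sup>2 = p + q\<^sup>2 * d"
              by (simp only: minus)
            have p: "p + w\<^sup>2 = q\<^sup>2 * d"
              unfolding w add.assoc[symmetric] dbl by simp
            \<comment> \<open>Dividing \<open>p + w\<^sup>2 = q\<^sup>2 d\<close> by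
              \<open>q\<^sup>2\<close> suggests \<open>s = 1 / q\<close> and
              \<open>t = w / q\<close>.\<close>
            have "(inverse q)\<^sup>2 * p + (w / q)\<^sup>2 = (p + w\<^sup>2) / q\<^sup>2"
              by (simp add: field_simps q)
            also have "\<dots> = d" using q by (simp add: p)
            finally have "isomorphic_to (D_2 d)" using q by (intro iso'[of "inverse q"]) simp_all
            then show ?thesis using char \<open>d \<in> R\<close> False by blast
          qed
        qed
      qed
    qed
  qed
  then show ?thesis
    unfolding C1 A1_algebras_def bex_Un bex_simps by argo
qed

end
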